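(* If $f:\mathbb{X}\to\mathbb{Y}^*$ is finite prefix-free and a measure $\mu$ on $(\mathbb{X}^{\mathbb{Z}},\mathcal{X}^{\mathbb{Z}})$ has finite energy, then the measure $\nu=\mu\circ(f^{\mathbb{Z}})^{-1}$ on $(\mathbb{Y}^{\mathbb{Z}},\mathcal{Y}^{\mathbb{Z}})$ has finite energy.
   Context: $\mathbb{X},\mathbb{Y}$ are countable alphabets; $\mathbb{Y}^+$ is the set of nonempty finite strings over $\mathbb{Y}$ and $\mathbb{Y}^*=\mathbb{Y}^+\cup\{\lambda\}$, $\lambda$ the empty string (similarly for $\mathbb{X}$); $|u|$ is string length. $(\mathbb{X}^{\mathbb{Z}},\mathcal{X}^{\mathbb{Z}})$, $(\mathbb{Y}^{\mathbb{Z}},\mathcal{Y}^{\mathbb{Z}})$ are the spaces of two-sided sequences with product $\sigma$-algebras; "measure" means probability measure. $f$ is prefix-free if it is an injection and $f(x)\ne f(x')s$ for all $x,x'\in\mathbb{X}$ and $s\in\mathbb{Y}^+$; it is called finite if $f(\mathbb{X})$ is finite. $f^{\mathbb{Z}}(x^{\mathbb{Z}})=\dots f(x_{-1})f(x_0)\mathbf{.}f(x_1)f(x_2)\dots$ is the two-sided concatenation ($f(x_1)$ starts at coordinate $1$); it is assumed that $f^{\mathbb{Z}}(x^{\mathbb{Z}})\in\mathbb{Y}^{\mathbb{Z}}$ for $\mu$-almost all $x^{\mathbb{Z}}$, so that $\nu$ is a measure on $\mathbb{Y}^{\mathbb{Z}}$. The cylinder of a string $u$ is $[u]=\{x^{\mathbb{Z}}:x_1\dots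 x_{|u|}=u\}$. A measure $\mu$ has finite energy if there exist $c<1$ and $K<\infty$ such that $\mu([uv])\le Kc^{|v|}\mu([u])$ for all finite strings $u,v$ (including empty ones). *)

theory Defs
  imports "HOL-Probability.Probability"
begin

type_synonym 'a biseq = "int \<Rightarrow> 'a"

definition seq_algebra :: "'a::countable biseq measure" where
  "seq_algebra = (\<Pi>\<^sub>M i\<in>UNIV. count_space UNIV)"

definition prob_on_seqs :: "'a::countable biseq measure \<Rightarrow> bool" where
  "prob_on_seqs M \<longleftrightarrow> prob_space M \<and> sets M = sets seq_algebra"

definition cylinder :: "'a list \<Rightarrow> 'a biseq set" where
  "cylinder u = {x. map x [1..int (length u)] = u}"

definition finite_energy :: "'a::countable biseq measure \<Rightarrow> bool" where
  "finite_energy M \<longleftrightarrow> (\<exists>c K :: real. c < 1 \<and>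
     (\<forall>u v. measure M (cylinder (u @ v)) \<le> K * c ^ length v * measure M (cylinder u)))"

definition prefix_free :: "('a \<Rightarrow> 'b list) \<Rightarrow> bool" where
  "prefix_free f \<longleftrightarrow> inj f \<and> (\<forall>x x' s. s \<noteq> [] \<longrightarrow> f x \<noteq> f x' @ s)"

definition finite_code :: "('a \<Rightarrow> 'b list) \<Rightarrow> bool" where
  "finite_code f \<longleftrightarrow> finite (range f)"

definition right_part :: "('a \<Rightarrow> 'b list) \<Rightarrow> 'a biseq \<Rightarrow> nat \<Rightarrow> 'b list" where
  "right_part f x n = concat (map (\<lambda>i. f (x i)) [1..int n])"

definition left_part :: "('a \<Rightarrow> 'b list) \<Rightarrow> 'a biseq \<Rightarrow> nat \<Rightarrow> 'b list" where
  "left_part f x n = concat (map (\<lambda>i. f (x i)) [1 - int n..0])"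

text \<open>The two-sided concatenation of the strings \<open>f (x i)\<close> fills all of \<open>\<int>\<close>
  iff the concatenations to the right and to the left of the origin are both infinite.\<close>

definition concat_biinfinite :: "('a \<Rightarrow> 'b list) \<Rightarrow> 'a biseq \<Rightarrow> bool" where
  "concat_biinfinite f x \<longleftrightarrow>
     (\<forall>k. \<exists>n. k < length (right_part f x n)) \<and> (\<forall>k. \<exists>n. k < length (left_part f x n))"

text \<open>Coordinate \<open>k \<ge> 1\<close> is the \<open>k\<close>-th letter of \<open>f (x 1) @ f (x 2) @ \<dots>\<close>;
  coordinate \<open>k \<le> 0\<close> is the letter of \<open>\<dots> @ f (x (-1)) @ f (x 0)\<close> followed by
  exactly \<open>-k\<close> letters. Finite sections long enough to contain the letter all agree on it, so
  the least one is taken. Where the concatenation is not bi-infinite, the value is an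
  arbitrary constant sequence.\<close>

definition code_seq :: "('a \<Rightarrow> 'b list) \<Rightarrow> 'a biseq \<Rightarrow> 'b biseq" where
  "code_seq f x k =
     (if \<not> concat_biinfinite f x then undefined
      else if 1 \<le> k then
        right_part f x (LEAST n. nat (k - 1) < length (right_part f x n)) ! nat (k - 1)
      else
        rev (left_part f x (LEAST n. nat (- k) < length (left_part f x n))) ! nat (- k))"

text \<open>\<^const>\<open>distr\<close> is the image measure only for measurable maps, which is verified below.\<close>

definition code_measure ::
    "('a::countable \<Rightarrow> 'b::countable list) \<Rightarrow> 'a biseq measure \<Rightarrow> 'b biseq measure" where
  "code_measure f M = distr M seq_algebra (code_seq f)"

lemma measurable_map_coordinates:
  "(\<lambda>x. map x is) \<in> measurable (seq_algebra :: 'a::countable biseq measure) (count_space UNIV)"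
proof (induction "is")
  case (Cons i js)
  have c: "(\<lambda>x. x i) \<in> measurable (seq_algebra :: 'a biseq measure) (count_space UNIV)"
    unfolding seq_algebra_def by (rule measurable_component_singleton) simp
  have "(\<lambda>x. (\<lambda>l x. x i # l) (map x js) x) \<in> measurable (seq_algebra :: 'a biseq measure) (count_space UNIV)"
  proof (rule measurable_compose_countable[where g = "\<lambda>x. map x js" and f = "\<lambda>l x. x i # l", OF _ Cons.IH])
    fix l :: "'a list"
    show "(\<lambda>x. x i # l) \<in> measurable (seq_algebra :: 'a biseq measure) (count_space UNIV)"
      using measurable_compose[OF c, of "\<lambda>a. a # l" "count_space UNIV"] by simp
  qed
  then show ?case by simp
qed simp

lemma measurable_right_part:
  "(\<lambda>x. right_part f x n) \<in> measurable (seq_algebra :: 'a::countable biseq measure) (count_space UNIV)"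
  using measurable_compose[OF measurable_map_coordinates, of "\<lambda>l. concat (map f l)" "count_space UNIV"]
  by (simp add: right_part_def comp_def)

lemma measurable_left_part:
  "(\<lambda>x. left_part f x n) \<in> measurable (seq_algebra :: 'a::countable biseq measure) (count_space UNIV)"
  using measurable_compose[OF measurable_map_coordinates, of "\<lambda>l. concat (map f l)" "count_space UNIV"]
  by (simp add: left_part_def comp_def)

lemma measurable_code_seq:
  fixes f :: "'a::countable \<Rightarrow> 'b::countable list"
  shows "code_seq f \<in> measurable seq_algebra seq_algebra"
proof -
  have [measurable]: "(\<lambda>x. right_part f x n) \<in> measurable seq_algebra (count_space UNIV)"
    "(\<lambda>x. left_part f x n) \<in> measurable seq_algebra (count_space UNIV)" for n
    by (rule measurable_right_part measurable_left_part)+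
  have [measurable]: "Measurable.pred seq_algebra (concat_biinfinite f)"
    unfolding concat_biinfinite_def by measurable
  have 1: "(\<lambda>x. right_part f x (LEAST n. j < length (right_part f x n)) ! j)
      \<in> measurable seq_algebra (count_space UNIV)" for j
    by (rule measurable_compose_countable[where g = "\<lambda>x. LEAST n. j < length (right_part f x n)"])
      measurable
  have 2: "(\<lambda>x. rev (left_part f x (LEAST n. j < length (left_part f x n))) ! j)
      \<in> measurable seq_algebra (count_space UNIV)" for j
    by (rule measurable_compose_countable[where g = "\<lambda>x. LEAST n. j < length (left_part f x n)"])
      measurable
  note [measurable] = 1 2
  have "(\<lambda>x. code_seq f x k) \<in> measurable seq_algebra (count_space UNIV)" for k
    unfolding code_seq_def by (cases "1 \<le> k") simp_all
  then show ?thesis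
    unfolding seq_algebra_def[where 'a = 'b]
    by (intro measurable_PiM_single') auto
qed

lemma prob_on_seqs_code_measure:
  assumes "prob_on_seqs M"
  shows "prob_on_seqs (code_measure f M)"
proof -
  interpret prob_space M using assms by (simp add: prob_on_seqs_def)
  have "code_seq f \<in> measurable M seq_algebra"
    using assms measurable_code_seq[of f] measurable_cong_sets[of M seq_algebra seq_algebra seq_algebra]
    by (auto simp: prob_on_seqs_def)
  then show ?thesis
    by (simp add: prob_on_seqs_def code_measure_def prob_space_distr)
qed

end

theory Submission
  imports Defs "HOL-Library.Sublist"
begin

text \<open>
  Up to a null set, the event that the coded sequence starts with \<open>u @ v\<close> can be compared with
  cylinders of the source. Take one source sequence \<open>y\<close> in that event. Cut its decoding at two
  places: after \<open>m\<close> letters, where the code of \<open>y\<close> has just covered \<open>u\<close>, and after \<open>n\<close> letters,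
  where it is about to leave \<open>u @ v\<close>. By prefix-freeness every other source sequence in the event
  has the same first \<open>n\<close> letters, so the event lies in the cylinder of \<open>y\<^sub>1 \<dots> y\<^sub>n\<close>. Conversely,
  every source sequence in the cylinder of \<open>y\<^sub>1 \<dots> y\<^sub>m\<close> is encoded into a sequence that starts
  with \<open>u\<close>. Finite energy of the source compares the two cylinders at the price of a factor
  \<open>K * c ^ (n - m)\<close>.

  If \<open>L\<close> bounds the length of the codewords, then each cut misses its target by at most \<open>L\<close>
  letters, whence \<open>length v \<le> (n - m) * L + 2 * L\<close>. So \<open>c ^ (n - m)\<close> decays exponentially in
  \<open>length v\<close>, at the rate of the \<open>L\<close>-th root of \<open>c\<close>; the boundary effect of \<open>2 * L\<close> letters goes
  into the constant.
\<close>

lemma upto_nat_split: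
  "m \<le> n \<Longrightarrow> [1..int n] = [1..int m] @ [int m + 1..int n]"
  by (cases m) (use upto_split2[of 1 "int m" "int n"] in auto)

lemma right_part_0 [simp]: "right_part f x 0 = []"
  by (simp add: right_part_def)

lemma right_part_Suc: "right_part f x (Suc n) = right_part f x n @ f (x (int n + 1))"
  using upto_nat_split[of n "Suc n"] by (simp add: right_part_def add.commute)

lemma right_part_conv_map: "right_part f x n = concat (map f (map x [1..int n]))"
  by (simp add: right_part_def comp_def)

lemma prefix_right_part: "m \<le> n \<Longrightarrow> prefix (right_part f x m) (right_part f x n)"
  unfolding right_part_def by (simp add: upto_nat_split[of m n])

lemma concat_biinfiniteE:
  assumes "concat_biinfinite f x"
  obtains n where "k < length (right_part f x n)"
  using assms by (auto simp: concat_biinfinite_def)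

section \<open>Codes of sequences and cylinders\<close>

lemma code_seq_eq_nth_right_part:
  assumes "concat_biinfinite f x" and "j < length (right_part f x n)"
  shows "code_seq f x (int j + 1) = right_part f x n ! j"
proof -
  define l where "l = (LEAST n. j < length (right_part f x n))"
  have l: "j < length (right_part f x l)" "l \<le> n"
    unfolding l_def using assms(2) by (auto intro: LeastI Least_le)
  have "right_part f x n ! j = right_part f x l ! j"
    using prefix_right_part[OF l(2), of f x] l(1) by (auto simp: prefix_def nth_append)
  then show ?thesis
    using assms(1) by (simp add: code_seq_def l_def)
qed

lemma mem_cylinder_iff: "z \<in> cylinder u \<longleftrightarrow> (\<forall>j < length u. z (int j + 1) = u ! j)"
proof -
  have "map z [1..int (length u)] = u
      \<longleftrightarrow> (\<forall>j < length u. map z [1..int (length u)] ! j = u ! j)"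
    by (subst list_eq_iff_nth_eq) simp
  also have "\<dots> \<longleftrightarrow> (\<forall>j < length u. z (int j + 1) = u ! j)"
    by (simp add: add.commute)
  finally show ?thesis
    by (simp add: cylinder_def)
qed

lemma code_seq_mem_cylinder_iff:
  assumes "concat_biinfinite f x" and "length u \<le> length (right_part f x n)"
  shows "code_seq f x \<in> cylinder u \<longleftrightarrow> prefix u (right_part f x n)"
proof -
  have "code_seq f x \<in> cylinder u \<longleftrightarrow> (\<forall>j < length u. right_part f x n ! j = u ! j)"
    using assms code_seq_eq_nth_right_part[OF assms(1), of _ n] by (auto simp: mem_cylinder_iff)
  also have "\<dots> \<longleftrightarrow> take (length u) (right_part f x n) = u"
    using assms(2) by (auto simp: list_eq_iff_nth_eq)
  also have "\<dots> \<longleftrightarrow> prefix u (right_part f x n)"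
    by (metis append_eq_conv_conj prefix_def take_is_prefix)
  finally show ?thesis .
qed

lemma cylinder_append_subset: "cylinder (u @ v) \<subseteq> cylinder u"
  by (auto simp: mem_cylinder_iff nth_append)

lemma cylinder_measurable [measurable]: "cylinder u \<in> sets seq_algebra"
proof -
  have "(\<lambda>x. map x [1..int (length u)]) -` {u} \<inter> space seq_algebra \<in> sets seq_algebra"
    by (rule measurable_sets[OF measurable_map_coordinates]) simp
  also have "(\<lambda>x. map x [1..int (length u)]) -` {u} \<inter> space seq_algebra = cylinder u"
    by (auto simp: cylinder_def seq_algebra_def space_PiM)
  finally show ?thesis .
qed

section \<open>Unique decoding\<close>

lemma prefix_free_codeword_eq:
  assumes "prefix_free f" and "prefix (f a) (f b)"
  shows "a = b"
  using assms unfolding prefix_free_def by (metis append_Nil2 injD prefix_def)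

text \<open>The empty string is a prefix of every codeword, so in a prefix-free code it can only be a
  codeword if it is the only one, and then no concatenation is infinite.\<close>

lemma prefix_free_codeword_nonempty:
  assumes "prefix_free f" and "concat_biinfinite f x"
  shows "f a \<noteq> []"
proof
  assume a: "f a = []"
  have "f b = []" for b
    using prefix_free_codeword_eq[OF assms(1), of a b] a by simp
  then have "right_part f x n = []" for n
    by (simp add: right_part_def)
  then show False
    using concat_biinfiniteE[OF assms(2)] by force
qed

text \<open>The first codewords of both concatenations are prefixes of the longer one, hence comparable,
  hence equal, and can be cancelled. Nonempty codewords are essential: appending a letter with
  an empty codeword to \<open>w\<close> would not change its code.\<close>

lemma prefix_free_decode_prefix:
  assumes "prefix_free f" and "\<And>a. f a \<noteq> []"
    and "prefix (concat (map f w)) (concat (map f w'))"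
  shows "prefix w w'"
  using assms(3)
proof (induction w arbitrary: w')
  case (Cons a w)
  obtain b t where w': "w' = b # t"
    using Cons.prems assms(2) by (cases w') auto
  have "prefix (f a) (f b @ concat (map f t))" "prefix (f b) (f b @ concat (map f t))"
    using Cons.prems by (auto simp: w' prefix_def)
  then have "prefix (f a) (f b) \<or> prefix (f b) (f a)"
    by (rule prefix_same_cases)
  then have "a = b"
    using prefix_free_codeword_eq[OF assms(1)] by metis
  then show ?case
    using Cons by (simp add: w')
qed simp

text \<open>A source sequence whose code starts with \<open>w\<close> agrees with any other such source sequence
  for as long as the code of the latter stays inside \<open>w\<close>, because that part of the code is
  then also a prefix of the code of the former and can be decoded there.\<close>

lemma decode_determined_by_cylinder:
  assumes pf: "prefix_free f"
    and x: "concat_biinfinite f x" "code_seq f x \<in> cylinder w"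
    and y: "concat_biinfinite f y" "code_seq f y \<in> cylinder w"
    and n: "length (right_part f y n) \<le> length w"
  shows "x \<in> cylinder (map y [1..int n])"
proof -
  obtain N where "length w < length (right_part f x N)"
    using x(1) by (rule concat_biinfiniteE)
  then have wx: "prefix w (right_part f x N)"
    using x code_seq_mem_cylinder_iff[of f x w N] by simp
  obtain N' where N': "length w < length (right_part f y N')"
    using y(1) by (rule concat_biinfiniteE)
  then have "prefix w (right_part f y N')"
    using y code_seq_mem_cylinder_iff[of f y w N'] by simp
  moreover have "n \<le> N'"
    using N' n prefix_length_le[OF prefix_right_part[of N' n f y]] by linarith
  ultimately have "prefix (right_part f y n) w"
    using prefix_right_part[of n N' f y] n prefix_length_prefix by blast
  then have "prefix (right_part f y n) (right_part f x N)"
    using wx by (rule prefix_order.trans)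
  then have p: "prefix (map y [1..int n]) (map x [1..int N])"
    unfolding right_part_conv_map
    by (rule prefix_free_decode_prefix[OF pf prefix_free_codeword_nonempty[OF pf x(1)]])
  then have "n \<le> N"
    using prefix_length_le[OF p] by simp
  then have "prefix (map x [1..int n]) (map x [1..int N])"
    using upto_nat_split[of n N] by (metis map_append prefixI)
  then have "prefix (map x [1..int n]) (map y [1..int n])"
    using p by (rule prefix_length_prefix) simp
  then have "map x [1..int n] = map y [1..int n]"
    by (metis append_Nil2 append_eq_append_conv length_map prefix_def)
  then show ?thesis
    by (simp add: cylinder_def)
qed

lemma cylinder_covers_code:
  assumes "prefix u (right_part f y m)"
    and "concat_biinfinite f x" and "x \<in> cylinder (map y [1..int m])"
  shows "code_seq f x \<in> cylinder u"
proof -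
  have "right_part f x m = right_part f y m"
    using assms(3) by (simp add: right_part_conv_map cylinder_def del: map_map map_eq_conv)
  then show ?thesis
    using assms(1,2) code_seq_mem_cylinder_iff[of f x u m] prefix_length_le[OF assms(1)] by simp
qed

section \<open>Codewords of bounded length\<close>

text \<open>The length of the code grows from zero to infinity in steps of at most \<open>L\<close>, so it cannot
  jump over an interval of length \<open>L\<close>.\<close>

lemma right_part_length_near:
  assumes "concat_biinfinite f x" and "\<And>a. length (f a) \<le> L"
  shows "\<exists>n. k \<le> length (right_part f x n) \<and> length (right_part f x n) \<le> k + L"
proof -
  obtain N where "k < length (right_part f x N)"
    using assms(1) by (rule concat_biinfiniteE)
  then have "k \<le> length (right_part f x N)"
    by simp
  then show ?thesis
  proof (induction N)
    case (Suc N)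
    then show ?case
      using assms(2)[of "x (int N + 1)"]
      by (cases "k \<le> length (right_part f x N)") (auto simp: right_part_Suc intro!: exI[of _ "Suc N"])
  qed (auto intro!: exI[of _ 0])
qed

lemma right_part_length_growth:
  assumes "\<And>a. length (f a) \<le> L"
  shows "length (right_part f x (m + d)) \<le> length (right_part f x m) + d * L"
proof (induction d)
  case (Suc d)
  then show ?case
    using assms[of "x (int (m + d) + 1)"] by (simp add: right_part_Suc)
qed simp

lemma finite_code_length_bound:
  assumes "finite_code f"
  obtains L where "0 < L" and "\<And>a. length (f a) \<le> L"
proof -
  have "finite (length ` range f)"
    using assms by (simp add: finite_code_def)
  then obtain L where "\<forall>l \<in> length ` range f. l \<le> L"
    using finite_nat_set_iff_bounded_le by blast
  then show ?thesis
    by (intro that[of "Suc L"]) (auto intro: le_SucI)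
qed

section \<open>Finite energy\<close>

lemma measure_cylinder_Nil:
  assumes "prob_on_seqs M"
  shows "measure M (cylinder []) = 1"
proof -
  interpret prob_space M using assms by (simp add: prob_on_seqs_def)
  have "space M = UNIV"
    using assms sets_eq_imp_space_eq[of M seq_algebra]
    by (simp add: prob_on_seqs_def seq_algebra_def space_PiM)
  then show ?thesis
    using prob_space by (simp add: cylinder_def)
qed

text \<open>Testing the inequality on the empty string forces \<open>K \<ge> 1\<close>, and testing it on a string of
  length one then excludes negative \<open>c\<close>. The rate can therefore be enlarged to a positive
  number, of which roots can be taken.\<close>

lemma finite_energy_positive_rate:
  fixes M :: "'a::countable biseq measure"
  assumes "prob_on_seqs M" and "finite_energy M"
  obtains c K :: real where "0 < c" "c < 1" "1 \<le> K"
    and "\<And>u v. measure M (cylinder (u @ v)) \<le> K * c ^ length v * measure M (cylinder u)"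
proof -
  obtain c K :: real where c: "c < 1"
    and le: "\<And>u v. measure M (cylinder (u @ v)) \<le> K * c ^ length v * measure M (cylinder u)"
    using assms(2) by (auto simp: finite_energy_def)
  have K: "1 \<le> K"
    using le[of "[]" "[]"] by (simp add: measure_cylinder_Nil[OF assms(1)])
  have "0 \<le> measure M (cylinder ([] @ [undefined]))"
    by simp
  also have "\<dots> \<le> K * c"
    using le[of "[]" "[undefined]"] by (simp add: measure_cylinder_Nil[OF assms(1)])
  finally have c0: "0 \<le> c"
    using K by (simp add: zero_le_mult_iff)
  show ?thesis
  proof (rule that[of "max c (1/2)" K])
    fix u v :: "'a list"
    have "K * c ^ length v * measure M (cylinder u)
        \<le> K * max c (1/2) ^ length v * measure M (cylinder u)"
      using c0 K by (intro mult_right_mono mult_left_mono power_mono) auto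
    with le[of u v] show "measure M (cylinder (u @ v))
        \<le> K * max c (1/2) ^ length v * measure M (cylinder u)"
      by linarith
  qed (use c K in auto)
qed

lemma code_seq_measurable_prob_on_seqs:
  assumes "prob_on_seqs M"
  shows "code_seq f \<in> measurable M seq_algebra"
  using assms measurable_code_seq[of f] measurable_cong_sets[of M seq_algebra seq_algebra seq_algebra]
  by (auto simp: prob_on_seqs_def)

text \<open>The comparison of cylinders described at the beginning. The strict bound
  \<open>2 * L < length v\<close> makes room for both cuts, in the right order, inside \<open>v\<close>.\<close>

lemma measure_code_cylinder_le:
  fixes f :: "'a::countable \<Rightarrow> 'b::countable list"
  assumes pf: "prefix_free f" and L: "\<And>a. length (f a) \<le> L"
    and M: "prob_on_seqs M" and good: "AE x in M. concat_biinfinite f x"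
    and v: "2 * L < length v"
    and pos: "0 < measure (code_measure f M) (cylinder (u @ v))"
  shows "\<exists>r s. length v \<le> length s * L + 2 * L \<and>
    measure (code_measure f M) (cylinder (u @ v)) \<le> measure M (cylinder (r @ s)) \<and>
    measure M (cylinder r) \<le> measure (code_measure f M) (cylinder u)"
proof -
  interpret prob_space M using M by (simp add: prob_on_seqs_def)
  define E where "E w = code_seq f -` cylinder w \<inter> space M" for w
  note meas = code_seq_measurable_prob_on_seqs[OF M, of f]
  have E: "measure (code_measure f M) (cylinder w) = measure M (E w)" for w
    unfolding code_measure_def E_def by (rule measure_distr[OF meas cylinder_measurable])
  have E_sets: "E w \<in> sets M" for w
    unfolding E_def by (rule measurable_sets[OF meas cylinder_measurable])
  have cyl_sets: "cylinder w \<in> sets M" for w :: "'a list"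
    using M by (simp add: prob_on_seqs_def)
  obtain y where y: "concat_biinfinite f y" "y \<in> E (u @ v)"
  proof (rule ccontr)
    assume "\<not> thesis"
    then have none: "\<And>y. concat_biinfinite f y \<Longrightarrow> y \<notin> E (u @ v)"
      using that by blast
    have "measure M (E (u @ v)) \<le> measure M {}"
      by (rule finite_measure_mono_AE, use good none in \<open>auto elim!: eventually_mono\<close>)
    with pos show False by (simp add: E)
  qed
  then have yuv: "code_seq f y \<in> cylinder (u @ v)"
    by (simp add: E_def)
  then have yu: "code_seq f y \<in> cylinder u"
    using cylinder_append_subset by blast
  \<comment> \<open>The code of the first \<open>m\<close> letters of \<open>y\<close> covers \<open>u\<close>, that of the first \<open>n\<close> letters does
    not exceed \<open>u @ v\<close>.\<close>
  obtain m where m: "length u \<le> length (right_part f y m)"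
      "length (right_part f y m) \<le> length u + L"
    using right_part_length_near[OF y(1) L] by blast
  obtain n where n: "length (u @ v) - L \<le> length (right_part f y n)"
      "length (right_part f y n) \<le> length (u @ v)"
    using right_part_length_near[OF y(1) L, of "length (u @ v) - L"] v by auto
  have "m \<le> n"
  proof (rule ccontr)
    assume "\<not> m \<le> n"
    then have "length (right_part f y n) \<le> length (right_part f y m)"
      by (intro prefix_length_le prefix_right_part) simp
    with m n v show False by simp
  qed
  define r s where "r = map y [1..int m]" and "s = map y [int m + 1..int n]"
  have rs: "r @ s = map y [1..int n]"
    by (simp add: r_def s_def upto_nat_split[OF \<open>m \<le> n\<close>])
  have len_s: "length s = n - m"
    using \<open>m \<le> n\<close> by (simp add: s_def nat_diff_distrib)
  have "length (right_part f y n) \<le> length (right_part f y m) + (n - m) * L"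
    using right_part_length_growth[of f L y m "n - m"] L \<open>m \<le> n\<close> by simp
  then have "length v \<le> length s * L + 2 * L"
    using m n v by (simp add: len_s)
  moreover have "measure M (E (u @ v)) \<le> measure M (cylinder (r @ s))"
  proof (rule finite_measure_mono_AE[OF _ cyl_sets])
    show "AE x in M. x \<in> E (u @ v) \<longrightarrow> x \<in> cylinder (r @ s)"
      using good
    proof eventually_elim
      case (elim x)
      then show ?case
        using decode_determined_by_cylinder[OF pf elim _ y(1) yuv n(2)] by (simp add: rs E_def)
    qed
  qed
  moreover have "measure M (cylinder r) \<le> measure M (E u)"
  proof (rule finite_measure_mono_AE[OF _ E_sets])
    have pu: "prefix u (right_part f y m)"
      using code_seq_mem_cylinder_iff[OF y(1) m(1)] yu by simp
    show "AE x in M. x \<in> cylinder r \<longrightarrow> x \<in> E u"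
      using good AE_space
    proof eventually_elim
      case (elim x)
      then show ?case
        using cylinder_covers_code[OF pu elim(1)] by (simp add: r_def E_def)
    qed
  qed
  ultimately show ?thesis
    by (auto simp: E)
qed

theorem corollary5p5:
  fixes f :: "'a::countable \<Rightarrow> 'b::countable list"
    and \<mu> :: "(int \<Rightarrow> 'a) measure"
  assumes "prefix_free f"
    and "finite_code f"
    and "prob_on_seqs \<mu>"
    and "AE x in \<mu>. concat_biinfinite f x"
    and "finite_energy \<mu>"
  shows "finite_energy (code_measure f \<mu>)"
proof -
  obtain L where L: "0 < L" "\<And>a. length (f a) \<le> L"
    using finite_code_length_bound[OF assms(2)] by blast
  obtain c K :: real where c: "0 < c" "c < 1" and K: "1 \<le> K"
    and le: "\<And>u v. measure \<mu> (cylinder (u @ v)) \<le> K * c ^ length v * measure \<mu> (cylinder u)"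
    using finite_energy_positive_rate[OF assms(3,5)] by blast
  let ?\<nu> = "\<lambda>w. measure (code_measure f \<mu>) (cylinder w)"
  interpret \<nu>: prob_space "code_measure f \<mu>"
    using prob_on_seqs_code_measure[OF assms(3), of f] by (simp add: prob_on_seqs_def)
  \<comment> \<open>The rate of decay per code letter: \<open>L\<close> code letters cost at least one source letter.\<close>
  define d where "d = root L c"
  have d: "0 < d" "d < 1" "d ^ L = c"
    using c L(1) by (auto simp: d_def)
  have "?\<nu> (u @ v) \<le> K / d ^ (2 * L) * d ^ length v * ?\<nu> u" for u v
  proof -
    consider "?\<nu> (u @ v) = 0" | "length v \<le> 2 * L" | "2 * L < length v" "0 < ?\<nu> (u @ v)"
      by (metis measure_nonneg leI order_le_less)
    then show ?thesis
    proof cases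
      case 1
      then show ?thesis
        using d K by simp
    next
      case 2
      have "d ^ (2 * L) \<le> d ^ length v"
        using d 2 by (intro power_decreasing) auto
      also have "\<dots> \<le> K * d ^ length v"
        using K d by (simp add: mult_le_cancel_right1)
      finally have "1 \<le> K / d ^ (2 * L) * d ^ length v"
        using d by (simp add: field_simps)
      moreover have "?\<nu> (u @ v) \<le> ?\<nu> u"
        by (intro \<nu>.finite_measure_mono cylinder_append_subset)
          (simp add: code_measure_def cylinder_measurable)
      ultimately show ?thesis
        using mult_right_mono[of 1 "K / d ^ (2 * L) * d ^ length v" "?\<nu> u"] by simp
    next
      case 3
      obtain r s where rs: "length v \<le> length s * L + 2 * L"
          "?\<nu> (u @ v) \<le> measure \<mu> (cylinder (r @ s))" "measure \<mu> (cylinder r) \<le> ?\<nu> u"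
        using measure_code_cylinder_le[OF assms(1) L(2) assms(3,4) 3] by blast
      have "d ^ (2 * L) * c ^ length s = d ^ (length s * L + 2 * L)"
        by (simp add: power_add power_mult mult.commute flip: d(3))
      also have "\<dots> \<le> d ^ length v"
        using d rs(1) by (intro power_decreasing) auto
      finally have cs: "c ^ length s \<le> d ^ length v / d ^ (2 * L)"
        using d by (simp add: field_simps)
      have "?\<nu> (u @ v) \<le> K * c ^ length s * measure \<mu> (cylinder r)"
        using rs(2) le[of r s] by linarith
      also have "\<dots> \<le> K * (d ^ length v / d ^ (2 * L)) * ?\<nu> u"
        using cs rs(3) K c d by (intro mult_mono mult_left_mono) auto
      finally show ?thesis
        by simp
    qed
  qed
  with d(2) show ?thesis
    unfolding finite_energy_def by blast
qed

end
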